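(* Let $B_T$ be the conditionally optimal lower bound for a total order $T$ on the sample space $\Omega$. If $B_T$ has a breakable tie, then $B_T$ is not admissible.
   Context: Fix a finite nonempty set $S\subset\mathbb{R}$, an integer $n\ge 1$ and $\alpha\in(0,1)$ (the confidence level is $1-\alpha$). The sample space is $\Omega=\Omega(S,n)=\{(x_1,\dots,x_n)\in S^n: x_1\le\dots\le x_n\}$, with $N=|\Omega|$. $\mathcal{F}=\mathcal{F}(S)$ is the closed simplex of all probability distributions on $S$ (zero masses allowed), with the Euclidean topology on mass vectors, and $\mu(F)=\sum_{s\in S}sF(s)$. For $x\in\Omega$ containing $\hat x_s$ copies of $s$, $\Pr_F(x)=\frac{n!}{\prod_{s}\hat x_s!}\prod_{s\in S}F(s)^{\hat x_s}$ (with $0^0=1$), and $\Pr_F(A)=\sum_{x\in A}\Pr_F(x)$ for $A\subseteq\Omega$. A lower bound is any map $B:\Omega\to[-\infty,\infty]$. It is valid if $\Pr_F(\{x\in\Omega: B(x)>\mu(F)\})\le\alpha$ for every $F\in\mathcal{F}$. For valid bounds, $B_1$ dominates $B_2$ if $B_1(x)\ge B_2(x)$ for all $x\in\Omega$ with strict inequality for at least one $x$. A bound $B$ is admissible if it is valid and no valid bound dominates it. A total order $T$ on $\Omega$ is an enumeration $(x_{t_1},\dots,x_{t_N})$ of $\Omega$; a bound $B$ is consistent with $T$ if $B(x_{t_1})\le\dots\le B(x_{t_N})$. The conditionally optimal bound $B_T$ for $T$ is the (unique) valid bound consistent with $T$ that dominates every other valid bound consistent with $T$. Classically (Buehler) it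 exists and is given by $B_T(x_{t_k})=\min_{F\in\mathcal{F}_k}\mu(F)$ if $\mathcal{F}_k\neq\emptyset$ and $B_T(x_{t_k})=\infty$ if $\mathcal{F}_k=\emptyset$, where $\Omega_k=\{x_{t_k},\dots,x_{t_N}\}$ and $\mathcal{F}_k$ is the closure of $\{F\in\mathcal{F}:\Pr_F(\Omega_k)>\alpha\}$. $B_T$ has a breakable tie if there exists a total order $T'$ on $\Omega$ with which $B_T$ is consistent and whose conditionally optimal bound $B_{T'}$ satisfies $B_{T'}\neq B_T$. *)

theory Defs
  imports "HOL-Probability.Probability"
begin

definition sample_space :: "real set \<Rightarrow> nat \<Rightarrow> real list set" where
  "sample_space S n = {x. length x = n \<and> set x \<subseteq> S \<and> sorted x}"

definition distributions :: "real set \<Rightarrow> real pmf set" where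
  "distributions S = {F. set_pmf F \<subseteq> S}"

definition mean :: "real set \<Rightarrow> real pmf \<Rightarrow> real" where
  "mean S F = (\<Sum>s\<in>S. s * pmf F s)"

text \<open>Probability, under n independent draws from F, that the sorted sample is x
  (a multinomial probability).\<close>

definition sample_prob :: "real set \<Rightarrow> nat \<Rightarrow> real pmf \<Rightarrow> real list \<Rightarrow> real" where
  "sample_prob S n F x =
     fact n / (\<Prod>s\<in>S. fact (count_list x s)) * (\<Prod>s\<in>S. pmf F s ^ count_list x s)"

definition event_prob :: "real set \<Rightarrow> nat \<Rightarrow> real pmf \<Rightarrow> real list set \<Rightarrow> real" where
  "event_prob S n F A = (\<Sum>x\<in>A. sample_prob S n F x)"

text \<open>Bounds are maps defined on the sample space only. They are taken to be extensional
  (undefined elsewhere), so that equality of bounds is equality on the sample space.\<close>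

definition bounds :: "real set \<Rightarrow> nat \<Rightarrow> (real list \<Rightarrow> ereal) set" where
  "bounds S n = sample_space S n \<rightarrow>\<^sub>E UNIV"

definition valid :: "real set \<Rightarrow> nat \<Rightarrow> real \<Rightarrow> (real list \<Rightarrow> ereal) \<Rightarrow> bool" where
  "valid S n \<alpha> B \<longleftrightarrow> B \<in> bounds S n \<and>
     (\<forall>F\<in>distributions S.
        event_prob S n F {x \<in> sample_space S n. B x > ereal (mean S F)} \<le> \<alpha>)"

definition dominates ::
  "real set \<Rightarrow> nat \<Rightarrow> (real list \<Rightarrow> ereal) \<Rightarrow> (real list \<Rightarrow> ereal) \<Rightarrow> bool" where
  "dominates S n B1 B2 \<longleftrightarrow>
     (\<forall>x\<in>sample_space S n. B1 x \<ge> B2 x) \<and> (\<exists>x\<in>sample_space S n. B1 x > B2 x)"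

definition admissible :: "real set \<Rightarrow> nat \<Rightarrow> real \<Rightarrow> (real list \<Rightarrow> ereal) \<Rightarrow> bool" where
  "admissible S n \<alpha> B \<longleftrightarrow>
     valid S n \<alpha> B \<and> \<not> (\<exists>B'. valid S n \<alpha> B' \<and> dominates S n B' B)"

text \<open>A total order is an enumeration of the sample space without repetition, in increasing order.\<close>

definition total_order :: "real set \<Rightarrow> nat \<Rightarrow> real list list \<Rightarrow> bool" where
  "total_order S n T \<longleftrightarrow> distinct T \<and> set T = sample_space S n"

definition consistent :: "(real list \<Rightarrow> ereal) \<Rightarrow> real list list \<Rightarrow> bool" where
  "consistent B T \<longleftrightarrow> sorted (map B T)"

definition cond_optimal ::
  "real set \<Rightarrow> nat \<Rightarrow> real \<Rightarrow> real list list \<Rightarrow> (real list \<Rightarrow> ereal) \<Rightarrow> bool" where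
  "cond_optimal S n \<alpha> T B \<longleftrightarrow> valid S n \<alpha> B \<and> consistent B T \<and>
     (\<forall>B'. valid S n \<alpha> B' \<and> consistent B' T \<and> B' \<noteq> B \<longrightarrow> dominates S n B B')"

text \<open>For finite S and a total order T on the sample space, such a bound exists (Buehler); it is unique
  because bounds are extensional.\<close>

definition cond_optimal_bound ::
  "real set \<Rightarrow> nat \<Rightarrow> real \<Rightarrow> real list list \<Rightarrow> (real list \<Rightarrow> ereal)" where
  "cond_optimal_bound S n \<alpha> T = (THE B. cond_optimal S n \<alpha> T B)"

definition has_breakable_tie ::
  "real set \<Rightarrow> nat \<Rightarrow> real \<Rightarrow> real list list \<Rightarrow> bool" where
  "has_breakable_tie S n \<alpha> T \<longleftrightarrow>
     (\<exists>T'. total_order S n T' \<and> consistent (cond_optimal_bound S n \<alpha> T) T' \<and>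
           cond_optimal_bound S n \<alpha> T' \<noteq> cond_optimal_bound S n \<alpha> T)"

end

theory Submission
  imports Defs
begin

text \<open>
  A breakable tie exhibits a second order \<open>T'\<close> with which \<open>B\<^sub>T\<close> is consistent. Since \<open>B\<^sub>T\<close> is
  then a competitor in the optimality problem for \<open>T'\<close> and differs from the optimum for \<open>T'\<close>,
  it is dominated by that optimum, which is valid.

  This uses that conditionally optimal bounds exist. Rather than through minimisation over the
  closed sets of distributions in Buehler's formula, existence is obtained here from the
  pointwise supremum of all valid bounds consistent with a given order. That supremum is consistent
  and lies above every competitor; only its validity needs an argument
  (\<open>valid_sup_bound\<close>). The set where it exceeds a mean \<open>m\<close> is a final segment of the order, and
  at the first point of that segment a single competitor already exceeds \<open>m\<close>. By consistency this
  competitor exceeds \<open>m\<close> on the whole segment, so validity of that one competitor bounds the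
  probability of the segment.
\<close>

definition sup_bound ::
  "real set \<Rightarrow> nat \<Rightarrow> real \<Rightarrow> real list list \<Rightarrow> real list \<Rightarrow> ereal" where
  "sup_bound S n \<alpha> T =
     (\<lambda>x\<in>sample_space S n. SUP B\<in>{B. valid S n \<alpha> B \<and> consistent B T}. B x)"

lemma sup_bound_upper:
  assumes "valid S n \<alpha> B" "consistent B T" "x \<in> sample_space S n"
  shows "B x \<le> sup_bound S n \<alpha> T x"
  using assms by (auto simp: sup_bound_def intro!: SUP_upper)

lemma event_prob_mono:
  assumes "finite B" "A \<subseteq> B"
  shows "event_prob S n F A \<le> event_prob S n F B"
  unfolding event_prob_def
  by (intro sum_mono2 assms) (simp add: sample_prob_def prod_nonneg)

lemma consistent_nth_mono:
  assumes "consistent B T" "i \<le> j" "j < length T"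
  shows "B (T ! i) \<le> B (T ! j)"
  using assms sorted_nth_mono[of "map B T" i j] by (simp add: consistent_def)

lemma consistent_sup_bound:
  assumes "total_order S n T"
  shows "consistent (sup_bound S n \<alpha> T) T"
proof -
  have "sup_bound S n \<alpha> T (T ! i) \<le> sup_bound S n \<alpha> T (T ! j)"
    if "i \<le> j" "j < length T" for i j
  proof -
    have "T ! i \<in> sample_space S n" "T ! j \<in> sample_space S n"
      using assms that nth_mem[of _ T] by (simp_all add: total_order_def)
    moreover have "(SUP B\<in>{B. valid S n \<alpha> B \<and> consistent B T}. B (T ! i))
        \<le> (SUP B\<in>{B. valid S n \<alpha> B \<and> consistent B T}. B (T ! j))"
      using that by (intro SUP_mono) (blast intro: consistent_nth_mono)
    ultimately show ?thesis
      by (simp add: sup_bound_def)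
  qed
  thus ?thesis
    by (auto simp: consistent_def sorted_iff_nth_mono)
qed

text \<open>
  A supremum of valid bounds need not be valid, as the events on which they exceed a mean may add
  up. Bounds consistent with one order exceed it on nested final segments, so the events do not add
  up: their union is already the event of one of the bounds.
\<close>

lemma valid_sup_bound:
  assumes T: "total_order S n T" and "0 \<le> \<alpha>"
  shows "valid S n \<alpha> (sup_bound S n \<alpha> T)"
  unfolding valid_def
proof (intro conjI ballI)
  show "sup_bound S n \<alpha> T \<in> bounds S n"
    by (simp add: bounds_def sup_bound_def)
next
  fix F assume F: "F \<in> distributions S"
  define E where "E B = {x \<in> sample_space S n. B x > ereal (mean S F)}" for B
  have space: "set T = sample_space S n"
    using T by (simp add: total_order_def)
  have "event_prob S n F (E (sup_bound S n \<alpha> T)) \<le> \<alpha>"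
  proof (cases "\<exists>k. k < length T \<and> T ! k \<in> E (sup_bound S n \<alpha> T)")
    case False
    hence "E (sup_bound S n \<alpha> T) = {}"
      using space by (metis (no_types, lifting) E_def equals0I in_set_conv_nth mem_Collect_eq)
    thus ?thesis
      using \<open>0 \<le> \<alpha>\<close> by (simp add: event_prob_def)
  next
    case True
    define k where "k = (LEAST k. k < length T \<and> T ! k \<in> E (sup_bound S n \<alpha> T))"
    have k: "k < length T" "T ! k \<in> E (sup_bound S n \<alpha> T)"
      using LeastI_ex[OF True] by (auto simp: k_def)
    have "ereal (mean S F) < (SUP B\<in>{B. valid S n \<alpha> B \<and> consistent B T}. B (T ! k))"
      using k(2) by (simp add: E_def sup_bound_def split: if_splits)
    then obtain B where B: "valid S n \<alpha> B" "consistent B T" "ereal (mean S F) < B (T ! k)"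
      by (auto simp: less_SUP_iff)
    have "E (sup_bound S n \<alpha> T) \<subseteq> E B"
    proof
      fix x assume x: "x \<in> E (sup_bound S n \<alpha> T)"
      hence "x \<in> set T"
        by (simp add: E_def space)
      then obtain j where j: "j < length T" "x = T ! j"
        by (auto simp: in_set_conv_nth)
      have "k \<le> j"
        unfolding k_def using x j by (auto intro: Least_le)
      hence "B (T ! k) \<le> B x"
        using consistent_nth_mono[OF B(2)] j by simp
      thus "x \<in> E B"
        using x B(3) by (auto simp: E_def)
    qed
    moreover have "finite (E B)"
      by (rule finite_subset[of _ "set T"]) (auto simp: E_def space[symmetric])
    ultimately have "event_prob S n F (E (sup_bound S n \<alpha> T)) \<le> event_prob S n F (E B)"
      by (rule event_prob_mono[rotated])
    also have "\<dots> \<le> \<alpha>"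
      using B(1) F by (simp add: valid_def E_def)
    finally show ?thesis .
  qed
  thus "event_prob S n F {x \<in> sample_space S n. sup_bound S n \<alpha> T x > ereal (mean S F)} \<le> \<alpha>"
    by (simp add: E_def)
qed

lemma cond_optimal_sup_bound:
  assumes "total_order S n T" "0 \<le> \<alpha>"
  shows "cond_optimal S n \<alpha> T (sup_bound S n \<alpha> T)"
  unfolding cond_optimal_def
proof (intro conjI allI impI valid_sup_bound consistent_sup_bound assms)
  fix B assume B: "valid S n \<alpha> B \<and> consistent B T \<and> B \<noteq> sup_bound S n \<alpha> T"
  hence le: "\<forall>x\<in>sample_space S n. B x \<le> sup_bound S n \<alpha> T x"
    by (auto intro: sup_bound_upper)
  \<comment> \<open>Both bounds are extensional, so they already differ at a point of the sample space.\<close>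
  have "B \<in> extensional (sample_space S n)"
    using B by (auto simp: valid_def bounds_def PiE_def)
  moreover have "sup_bound S n \<alpha> T \<in> extensional (sample_space S n)"
    by (simp add: sup_bound_def)
  ultimately obtain x where "x \<in> sample_space S n" "B x \<noteq> sup_bound S n \<alpha> T x"
    using B by (meson extensionalityI)
  with le show "dominates S n (sup_bound S n \<alpha> T) B"
    by (meson dominates_def order_neq_le_trans)
qed

lemma cond_optimal_unique:
  assumes "cond_optimal S n \<alpha> T B1" "cond_optimal S n \<alpha> T B2"
  shows "B1 = B2"
proof (rule ccontr)
  assume "B1 \<noteq> B2"
  hence "dominates S n B1 B2" "dominates S n B2 B1"
    using assms by (auto simp: cond_optimal_def)
  thus False
    by (meson dominates_def leD)
qed

lemma cond_optimal_cond_optimal_bound: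
  assumes "total_order S n T" "0 \<le> \<alpha>"
  shows "cond_optimal S n \<alpha> T (cond_optimal_bound S n \<alpha> T)"
  unfolding cond_optimal_bound_def
  using theI'[of "cond_optimal S n \<alpha> T"] cond_optimal_sup_bound[OF assms] cond_optimal_unique
  by blast

theorem lemma3p7:
  fixes S :: "real set" and n :: nat and \<alpha> :: real and T :: "real list list"
  assumes "finite S" and "S \<noteq> {}" and "n \<ge> 1" and "0 < \<alpha>" and "\<alpha> < 1"
    and "total_order S n T"
    and "has_breakable_tie S n \<alpha> T"
  shows "\<not> admissible S n \<alpha> (cond_optimal_bound S n \<alpha> T)"
proof -
  let ?B = "cond_optimal_bound S n \<alpha>"
  obtain T' where T': "total_order S n T'" "consistent (?B T) T'" "?B T' \<noteq> ?B T"
    using \<open>has_breakable_tie S n \<alpha> T\<close> by (auto simp: has_breakable_tie_def)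
  have opt: "cond_optimal S n \<alpha> T (?B T)" "cond_optimal S n \<alpha> T' (?B T')"
    using cond_optimal_cond_optimal_bound assms T'(1) by auto
  hence "valid S n \<alpha> (?B T')" "dominates S n (?B T') (?B T)"
    using T' by (auto simp: cond_optimal_def)
  thus ?thesis
    by (auto simp: admissible_def)
qed

end
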